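(* Let $R(2)=\limsup_{n\to\infty}\frac{\log_2 SSM(2,n)}{n}$, where $SSM(2,n)$ is the maximum possible number of columns of a strongly $2$-separable matrix with $n$ rows. Then $R(2)\ge 0.2237$.
   Context: Let $M\ge n\ge 2$ be integers and let $B$ be a binary ($0$-$1$) matrix of size $n\times M$ with set of column vectors $\mathcal{F}=\{c_1,\ldots,c_M\}\subseteq\{0,1\}^n$ (the columns being pairwise distinct, $|\mathcal{F}|=M$). The Boolean sum $\bigvee$ of a set of columns is their coordinatewise maximum (OR). The matrix $B$ is called strongly $t$-separable (a $t$-SSM) if for every $\mathcal{F}_0\subseteq\mathcal{F}$ with $|\mathcal{F}_0|=t$ we have $\bigcap_{\mathcal{F}'\in\mathcal{U}(\mathcal{F}_0)}\mathcal{F}'=\mathcal{F}_0$, where $\mathcal{U}(\mathcal{F}_0)=\{\mathcal{F}'\subseteq\mathcal{F}:\ \bigvee_{c\in\mathcal{F}_0}c=\bigvee_{c\in\mathcal{F}'}c\}$. $SSM(t,n)$ denotes the maximum possible number of columns of a $t$-SSM with $n$ rows. *)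

theory Defs
  imports Complex_Main "HOL-Library.Extended_Real" "Jordan_Normal_Form.Matrix"
begin

definition binary_matrix :: "nat mat \<Rightarrow> bool" where
  "binary_matrix B \<longleftrightarrow> elements_mat B \<subseteq> {0, 1}"

text \<open>Boolean sum (coordinatewise maximum) of a set of 0-1 column vectors of length n.
  The inserted 0 only matters for the empty set, whose Boolean sum is the zero vector.\<close>

definition bool_sum :: "nat \<Rightarrow> nat vec set \<Rightarrow> nat vec" where
  "bool_sum n C = vec n (\<lambda>i. Max (insert 0 ((\<lambda>c. c $ i) ` C)))"

definition same_sum_subsets :: "nat mat \<Rightarrow> nat vec set \<Rightarrow> nat vec set set" where
  "same_sum_subsets B F0 =
     {F'. F' \<subseteq> set (cols B) \<and> bool_sum (dim_row B) F0 = bool_sum (dim_row B) F'}"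

definition strongly_separable :: "nat \<Rightarrow> nat mat \<Rightarrow> bool" where
  "strongly_separable t B \<longleftrightarrow>
     binary_matrix B \<and> distinct (cols B) \<and> 2 \<le> dim_row B \<and> dim_row B \<le> dim_col B \<and>
     (\<forall>F0. F0 \<subseteq> set (cols B) \<and> card F0 = t \<longrightarrow> \<Inter> (same_sum_subsets B F0) = F0)"

text \<open>Distinctness of the columns bounds their number by \<open>2 ^ n\<close>, so the maximum is over a
  finite set. For \<open>t = 2\<close> and \<open>n \<ge> 2\<close> it is nonempty, containing \<open>n\<close> (identity matrix);
  for \<open>n < 2\<close> the value is unspecified.\<close>

definition SSM :: "nat \<Rightarrow> nat \<Rightarrow> nat" where
  "SSM t n = Max {M. \<exists>B \<in> carrier_mat n M. strongly_separable t B}"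

end

theory Submission imports Defs begin

text \<open>
  Columns are identified with their supports. If \<open>a \<or> b = \<Or>F'\<close> for a family \<open>F'\<close> of
  columns omitting \<open>a\<close>, then every member of \<open>F'\<close> lies below \<open>a \<or> b\<close>. Hence, among columns
  that are pairwise incomparable, strong 2-separability can only fail through one of two
  configurations of distinct columns: a bad triple, where \<open>c \<le> a \<or> b\<close> and \<open>a \<le> b \<or> c\<close>, or a
  bad quadruple, where both \<open>c\<close> and \<open>d\<close> lie below \<open>a \<or> b\<close> (\<open>mem_of_Union_eq_Un\<close>). Covering
  families \<open>F'\<close> of unbounded size never have to be considered.

  Large codes without these configurations come from random selection with deletion
  (\<open>exists_large_independent_set\<close>): choose \<open>M\<close> of \<open>N\<close> candidates at random and delete one member of
  each bad configuration that survives. If there are \<open>e\<^sub>3\<close> bad triples and \<open>e\<^sub>4\<close> bad quadruples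
  among the candidates, at least \<open>M - e\<^sub>3 (M/N)\<^sup>3 - e\<^sub>4 (M/N)\<^sup>4\<close> columns remain.

  The candidates should have constant weight about a quarter of the length: with independent
  coordinates the atypically heavy columns dominate the number of bad quadruples, and the rate drops
  below \<open>0.14\<close>. To avoid asymptotics of binomial coefficients, constant weight is imposed
  block by block: the candidates are the words of length \<open>m\<close> over the alphabet of all \<open>5\<close>-subsets
  of a \<open>20\<close>-set, giving columns of length \<open>20 m\<close>. Both configurations can be tested in each block
  separately, so \<open>e\<^sub>3\<close> and \<open>e\<^sub>4\<close> are bounded by \<open>m\<close>-th powers of two explicit numbers
  (\<open>card_bad_triples_20_5\<close>, \<open>card_bad_quads_20_5\<close>). With alphabet size \<open>A = 15504\<close> and these numbers
  written \<open>T\<close> and \<open>Q\<close>, rates up to the smaller of \<open>log\<^sub>2 (A\<^sup>3 / T) / 40 = 0.283...\<close> and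
  \<open>log\<^sub>2 (A\<^sup>4 / Q) / 60 = 0.2255...\<close> are reached. The rate \<open>9/40 = 0.225\<close> used below lies between
  \<open>0.2237\<close> and this bound, and makes \<open>M = 2 ^ (9 l)\<close> an exact power of two when \<open>m = 2 l\<close>.
\<close>

section \<open>Deletion in a hypergraph\<close>

text \<open>
  The quotient of the two binomial coefficients is the product of the factors
  \<open>(M - i) / (N - i)\<close> for \<open>i < r\<close>, each of which is at most \<open>M / N\<close>. It is the probability that a
  random \<open>M\<close>-subset of an \<open>N\<close>-set contains a given \<open>r\<close>-subset.
\<close>

lemma binomial_diff_le_power:
  assumes "r \<le> M" "M \<le> N"
  shows "real ((N - r) choose (M - r)) \<le> real (N choose M) * (real M / real N) ^ r"
  using assms
proof (induction r)
  case 0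
  then show ?case by simp
next
  case (Suc r)
  have eq: "real (M - r) * real ((N - r) choose (M - r))
      = real (N - r) * real ((N - Suc r) choose (M - Suc r))"
    using Suc.prems binomial_absorption[of "M - Suc r" "N - r"]
    by (simp add: Suc_diff_Suc del: of_nat_diff flip: of_nat_mult)
  have pos: "real (N - r) > 0" "real N > 0" using Suc.prems by auto
  have "real (M - r) / real (N - r) \<le> real M / real N"
    using Suc.prems pos by (simp add: divide_simps of_nat_diff algebra_simps mult_right_mono)
  moreover have step: "real ((N - Suc r) choose (M - Suc r))
      = real ((N - r) choose (M - r)) * (real (M - r) / real (N - r))"
    using eq pos by (simp add: field_simps del: of_nat_diff)
  ultimately have "real ((N - Suc r) choose (M - Suc r))
      \<le> real ((N - r) choose (M - r)) * (real M / real N)"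
    by (simp only: step mult_left_mono of_nat_0_le_iff)
  also have "\<dots> \<le> (real (N choose M) * (real M / real N) ^ r) * (real M / real N)"
    using Suc by (intro mult_right_mono) auto
  finally show ?case by (simp add: algebra_simps)
qed

lemma card_supersets_le:
  assumes "finite V" "e \<subseteq> V" "M \<le> card V"
  shows "real (card {S. S \<subseteq> V \<and> card S = M \<and> e \<subseteq> S})
    \<le> real (card V choose M) * (real M / real (card V)) ^ card e"
proof (cases "card e \<le> M")
  case True
  have fin: "finite e" using assms finite_subset by auto
  have "card {S. S \<subseteq> V \<and> card S = M \<and> e \<subseteq> S} \<le> card {T. T \<subseteq> V - e \<and> card T = M - card e}"
  proof (rule card_inj_on_le[where f = "\<lambda>S. S - e"])
    show "inj_on (\<lambda>S. S - e) {S. S \<subseteq> V \<and> card S = M \<and> e \<subseteq> S}"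
      by (rule inj_onI) blast
    show "(\<lambda>S. S - e) ` {S. S \<subseteq> V \<and> card S = M \<and> e \<subseteq> S} \<subseteq> {T. T \<subseteq> V - e \<and> card T = M - card e}"
      using fin by (auto simp: card_Diff_subset)
    show "finite {T. T \<subseteq> V - e \<and> card T = M - card e}"
      using assms by (auto intro: finite_subset[of _ "Pow V"])
  qed
  also have "\<dots> = (card V - card e) choose (M - card e)"
    using assms fin by (simp add: n_subsets card_Diff_subset)
  finally show ?thesis
    using binomial_diff_le_power[OF True assms(3)] by linarith
next
  case False
  have "{S. S \<subseteq> V \<and> card S = M \<and> e \<subseteq> S} = {}"
    using False assms(1) by (auto dest: card_mono finite_subset)
  then show ?thesis by (simp only: card.empty) simp
qed

text \<open>
  The deletion method. The sum is an upper bound for the mean number of edges of the hypergraph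
  \<open>E\<close> inside a uniformly random \<open>M\<close>-subset of \<open>V\<close>; in a subset that does not exceed the mean,
  removing one vertex from each edge destroys all of them.
\<close>

lemma exists_large_independent_set:
  fixes V :: "'a set"
  assumes V: "finite V" and M: "M \<le> card V"
    and E: "finite E" "\<And>e. e \<in> E \<Longrightarrow> e \<subseteq> V" "{} \<notin> E"
  obtains S where "S \<subseteq> V" "\<And>e. e \<in> E \<Longrightarrow> \<not> e \<subseteq> S"
    "real (card S) \<ge> real M - (\<Sum>e\<in>E. (real M / real (card V)) ^ card e)"
proof -
  define W where "W = {S. S \<subseteq> V \<and> card S = M}"
  define t where "t = (\<Sum>e\<in>E. (real M / real (card V)) ^ card e)"
  have finW: "finite W" unfolding W_def using V by (auto intro: finite_subset[of _ "Pow V"])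
  have cardW: "card W = card V choose M" unfolding W_def using V by (rule n_subsets)
  \<comment> \<open>double counting of the pairs of an edge and an \<open>M\<close>-subset containing it\<close>
  have "(\<Sum>S\<in>W. real (card {e\<in>E. e \<subseteq> S})) = (\<Sum>S\<in>W. \<Sum>e\<in>E. if e \<subseteq> S then 1 else 0)"
    using E(1) by (simp add: sum.If_cases Int_def)
  also have "\<dots> = (\<Sum>e\<in>E. real (card {S. S \<subseteq> V \<and> card S = M \<and> e \<subseteq> S}))"
    using finW by (subst sum.swap) (simp add: sum.If_cases Int_def W_def conj_assoc)
  also have "\<dots> \<le> (\<Sum>e\<in>E. real (card W) * (real M / real (card V)) ^ card e)"
    unfolding cardW by (intro sum_mono card_supersets_le V M E)
  also have "\<dots> = (\<Sum>S\<in>W. t)" by (simp add: t_def sum_distrib_left)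
  finally have le: "(\<Sum>S\<in>W. real (card {e\<in>E. e \<subseteq> S})) \<le> (\<Sum>S\<in>W. t)" .
  have "W \<noteq> {}" using cardW M by (metis binomial_eq_0_iff card.empty leD)
  then obtain S where S: "S \<in> W" "real (card {e\<in>E. e \<subseteq> S}) \<le> t"
    using le sum_strict_mono[OF finW, of "\<lambda>_. t" "\<lambda>S. real (card {e\<in>E. e \<subseteq> S})"]
    by (meson linorder_not_le)
  \<comment> \<open>one vertex from every edge contained in \<open>S\<close>\<close>
  define X where "X = (\<lambda>e. SOME x. x \<in> e) ` {e\<in>E. e \<subseteq> S}"
  have some: "(SOME x. x \<in> e) \<in> e" if "e \<in> E" for e
    using that E(3) by (metis some_in_eq)
  have finX: "finite X" unfolding X_def using E(1) by auto
  have cardX: "card X \<le> card {e\<in>E. e \<subseteq> S}"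
    unfolding X_def using E(1) by (intro card_image_le) auto
  have "real (card (S - X)) \<ge> real M - real (card X)"
    using diff_card_le_card_Diff[OF finX, of S] S(1) by (simp add: W_def)
  then have "real (card (S - X)) \<ge> real M - t" using cardX S(2) by linarith
  moreover have "\<not> e \<subseteq> S - X" if "e \<in> E" for e
    using some[OF that] that unfolding X_def by blast
  moreover have "S - X \<subseteq> V" using S(1) W_def by auto
  ultimately show ?thesis using that t_def by blast
qed

section \<open>Strong separability of set families\<close>

definition incidence :: "nat \<Rightarrow> nat set \<Rightarrow> nat vec" where
  "incidence n S = vec n (\<lambda>i. if i \<in> S then 1 else 0)"

lemma inj_on_incidence: "inj_on (incidence n) (Pow {..<n})"
proof (rule inj_onI)
  fix S T assume S: "S \<in> Pow {..<n}" and T: "T \<in> Pow {..<n}"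
    and eq: "incidence n S = incidence n T"
  have "i \<in> S \<longleftrightarrow> i \<in> T" if "i < n" for i
    using arg_cong[OF eq, of "\<lambda>v. v $ i"] that by (auto simp: incidence_def split: if_splits)
  then show "S = T" using S T by blast
qed

lemma bool_sum_incidence:
  assumes "finite G"
  shows "bool_sum n (incidence n ` G) = incidence n (\<Union>G)"
proof -
  have "Max (insert 0 ((\<lambda>c. c $ i) ` incidence n ` G)) = (if i \<in> \<Union>G then 1 else 0)" if "i < n" for i
    using assms that by (intro Max_eqI) (auto simp: incidence_def image_image)
  then show ?thesis unfolding bool_sum_def incidence_def[of n "\<Union>G"] by auto
qed

text \<open>
  In set language, \<open>F0 = {a, b}\<close> equals the intersection of all families with the same Boolean sum
  as soon as no family with union \<open>a \<union> b\<close> omits \<open>a\<close>; the requirement for \<open>b\<close> is the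
  same one with the roles exchanged.
\<close>

lemma strongly_separable_of_family:
  assumes n: "2 \<le> n" and A: "A \<subseteq> Pow {..<n}" "n \<le> card A"
    and sep: "\<And>a b G. \<lbrakk>a \<in> A; b \<in> A; a \<noteq> b; G \<subseteq> A; \<Union>G = a \<union> b\<rbrakk> \<Longrightarrow> a \<in> G"
  shows "\<exists>B \<in> carrier_mat n (card A). strongly_separable 2 B"
proof -
  have finA: "finite A" using A finite_subset by blast
  have inj: "inj_on (incidence n) A" using inj_on_incidence A(1) by (rule inj_on_subset)
  obtain vs where vs: "set vs = incidence n ` A" "distinct vs"
    using finite_distinct_list[of "incidence n ` A"] finA by blast
  have len: "length vs = card A"
    using vs distinct_card card_image[OF inj] by metis
  define B where "B = mat_of_cols n vs"
  have B: "B \<in> carrier_mat n (card A)" by (simp add: B_def flip: len)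
  have cols: "cols B = vs"
    unfolding B_def using vs by (intro cols_mat_of_cols) (auto simp: incidence_def)
  have "binary_matrix B"
    unfolding binary_matrix_def
  proof
    fix x assume "x \<in> elements_mat B"
    then obtain i j where ij: "i < n" "j < card A" "x = B $$ (i, j)" using B by auto
    have "vs ! j \<in> incidence n ` A" using ij vs len by (metis nth_mem)
    moreover have "B $$ (i, j) = vs ! j $ i"
      using ij len by (simp add: B_def mat_of_cols_index)
    ultimately show "x \<in> {0, 1}" using ij by (auto simp: incidence_def)
  qed
  moreover have "\<Inter> (same_sum_subsets B F0) = F0" if F0: "F0 \<subseteq> set (cols B)" "card F0 = 2" for F0
  proof
    have "F0 \<in> same_sum_subsets B F0" using F0 by (simp add: same_sum_subsets_def)
    then show "\<Inter> (same_sum_subsets B F0) \<subseteq> F0" by blast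
    obtain G0 where G0: "G0 \<subseteq> A" "F0 = incidence n ` G0"
      using F0(1) unfolding cols vs(1) by (auto simp: subset_image_iff)
    have "card G0 = 2" using F0(2) G0 inj by (metis card_image inj_on_subset)
    then have finG0: "finite G0" using card.infinite by fastforce
    show "F0 \<subseteq> \<Inter> (same_sum_subsets B F0)"
    proof (intro Inter_greatest)
      fix F' assume F': "F' \<in> same_sum_subsets B F0"
      then obtain G' where G': "G' \<subseteq> A" "F' = incidence n ` G'"
        unfolding same_sum_subsets_def cols vs(1) by (auto simp: subset_image_iff)
      have "bool_sum n (incidence n ` G0) = bool_sum n (incidence n ` G')"
        using F' B G0 G' by (auto simp: same_sum_subsets_def)
      then have "incidence n (\<Union>G0) = incidence n (\<Union>G')"
        using bool_sum_incidence finG0 G'(1) finA finite_subset by metis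
      moreover have "\<Union>G0 \<in> Pow {..<n}" "\<Union>G' \<in> Pow {..<n}" using G0 G' A(1) by blast+
      ultimately have eq: "\<Union>G' = \<Union>G0" using inj_on_incidence by (metis inj_onD)
      have "a \<in> G'" if a: "a \<in> G0" for a
      proof -
        obtain b where b: "G0 = {a, b}" "a \<noteq> b"
          using \<open>card G0 = 2\<close> a by (auto simp: card_2_iff)
        then show ?thesis using sep[of a b G'] G0 G' eq by auto
      qed
      then show "F0 \<subseteq> F'" using G0 G' by blast
    qed
  qed
  ultimately have "strongly_separable 2 B"
    unfolding strongly_separable_def using B vs n A(2) cols by auto
  then show ?thesis using B by blast
qed

text \<open>
  A maximum over an unbounded set would be unspecified, so the bound \<open>2 ^ n\<close> on the number of
  distinct binary columns has to be established first.
\<close>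

lemma SSM_ge:
  assumes "B \<in> carrier_mat n M" "strongly_separable t B"
  shows "M \<le> SSM t n"
proof -
  have "{M. \<exists>B \<in> carrier_mat n M. strongly_separable t B} \<subseteq> {..2 ^ n}"
  proof
    fix M assume "M \<in> {M. \<exists>B \<in> carrier_mat n M. strongly_separable t B}"
    then obtain B where B: "B \<in> carrier_mat n M" "strongly_separable t B" by blast
    have "set (cols B) \<subseteq> incidence n ` Pow {..<n}"
    proof
      fix v assume "v \<in> set (cols B)"
      then obtain j where j: "j < M" "v = col B j" using B by (auto simp: cols_def)
      have v01: "v $ i \<in> {0, 1}" if "i < n" for i
      proof -
        have "B $$ (i, j) \<in> elements_mat B" using B j that by auto
        then show ?thesis using B j that by (auto simp: strongly_separable_def binary_matrix_def)
      qed
      have "v = incidence n {i. i < n \<and> v $ i = 1}"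
        unfolding incidence_def using v01 B j by (intro eq_vecI) auto
      then show "v \<in> incidence n ` Pow {..<n}" by blast
    qed
    then have "card (set (cols B)) \<le> card (incidence n ` Pow {..<n})" by (intro card_mono) auto
    also have "\<dots> \<le> 2 ^ n"
      using card_image_le[of "Pow {..<n}" "incidence n"] by (simp add: card_Pow)
    finally have "card (set (cols B)) \<le> 2 ^ n" .
    moreover have "card (set (cols B)) = M"
      using B by (simp add: strongly_separable_def distinct_card)
    ultimately show "M \<in> {..2 ^ n}" by simp
  qed
  then have "finite {M. \<exists>B \<in> carrier_mat n M. strongly_separable t B}"
    using finite_subset by blast
  then show ?thesis unfolding SSM_def using assms by (intro Max_ge) auto
qed

text \<open>
  Suppose \<open>G\<close> omits \<open>a\<close>. All its members are contained in \<open>a \<union> b\<close>, so without bad quadruples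
  at most one of them, \<open>c\<close>, differs from \<open>b\<close>. If there is none, then \<open>a \<subseteq> b\<close>; otherwise
  \<open>b\<close> and \<open>c\<close> together cover \<open>a\<close>, which makes a bad triple.
\<close>

lemma mem_of_Union_eq_Un:
  assumes ab: "a \<in> A" "b \<in> A" "a \<noteq> b" and G: "G \<subseteq> A" "\<Union>G = a \<union> b"
    and antichain: "\<not> a \<subseteq> b"
    and triple: "\<And>c. \<lbrakk>c \<in> A; c \<noteq> a; c \<noteq> b; c \<subseteq> a \<union> b; a \<subseteq> b \<union> c\<rbrakk> \<Longrightarrow> False"
    and quad: "\<And>c d. \<lbrakk>c \<in> A; d \<in> A; c \<noteq> a; c \<noteq> b; d \<noteq> a; d \<noteq> b; c \<noteq> d;
      c \<subseteq> a \<union> b; d \<subseteq> a \<union> b\<rbrakk> \<Longrightarrow> False"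
  shows "a \<in> G"
proof (rule ccontr)
  assume aG: "a \<notin> G"
  have "\<exists>c\<in>G. c \<noteq> b"
  proof (rule ccontr)
    assume "\<not> (\<exists>c\<in>G. c \<noteq> b)"
    then have "\<Union>G \<subseteq> b" by blast
    then show False using G(2) antichain by blast
  qed
  then obtain c where c: "c \<in> G" "c \<noteq> b" by blast
  have "d = c" if "d \<in> G" "d \<noteq> b" for d
    using quad[of c d] that c aG G by blast
  then have "\<Union>G \<subseteq> b \<union> c" by blast
  then show False using triple[of c] c aG G by blast
qed

section \<open>Counting bad configurations\<close>

definition layer :: "nat \<Rightarrow> nat \<Rightarrow> nat set set" where
  "layer k w = {a. a \<subseteq> {..<k} \<and> card a = w}"

lemma finite_layer [simp]: "finite (layer k w)"
  unfolding layer_def by (auto intro: finite_subset[of _ "Pow {..<k}"])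

lemma card_layer: "card (layer k w) = k choose w"
  unfolding layer_def by (simp add: n_subsets)

lemma layerD: "a \<in> layer k w \<Longrightarrow> a \<subseteq> {..<k} \<and> card a = w \<and> finite a"
  unfolding layer_def using finite_subset by blast

text \<open>
  A set is determined by its parts inside and outside \<open>b\<close>, of sizes \<open>j\<close> and \<open>w - j\<close>.
\<close>

lemma card_layer_Int:
  assumes "b \<in> layer k w" "j \<le> w"
  shows "card {a \<in> layer k w. card (a \<inter> b) = j} \<le> (w choose j) * ((k - w) choose (w - j))"
proof -
  note b = layerD[OF assms(1)]
  let ?P = "{s. s \<subseteq> b \<and> card s = j} \<times> {t. t \<subseteq> {..<k} - b \<and> card t = w - j}"
  have fin: "finite ?P"
    using b by (auto intro!: finite_cartesian_product intro: finite_subset[of _ "Pow b"]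
      finite_subset[of _ "Pow {..<k}"])
  have "card {a \<in> layer k w. card (a \<inter> b) = j} \<le> card ?P"
  proof (rule card_inj_on_le[where f = "\<lambda>a. (a \<inter> b, a - b)"])
    show "inj_on (\<lambda>a. (a \<inter> b, a - b)) {a \<in> layer k w. card (a \<inter> b) = j}"
      by (rule inj_onI) blast
    show "(\<lambda>a. (a \<inter> b, a - b)) ` {a \<in> layer k w. card (a \<inter> b) = j} \<subseteq> ?P"
      by (auto simp: card_Diff_subset_Int dest: layerD)
  qed (rule fin)
  also have "\<dots> = (w choose j) * ((k - w) choose (w - j))"
    using b by (simp add: card_cartesian_product n_subsets card_Diff_subset)
  finally show ?thesis .
qed

lemma sum_layer_pairs_le:
  fixes f :: "nat \<Rightarrow> nat"
  shows "(\<Sum>b\<in>layer k w. \<Sum>a\<in>layer k w. f (card (a \<inter> b)))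
    \<le> (k choose w) * (\<Sum>j\<le>w. (w choose j) * ((k - w) choose (w - j)) * f j)"
proof -
  have "(\<Sum>a\<in>layer k w. f (card (a \<inter> b))) \<le> (\<Sum>j\<le>w. (w choose j) * ((k - w) choose (w - j)) * f j)"
    if b: "b \<in> layer k w" for b
  proof -
    have "card (a \<inter> b) \<le> w" for a using layerD[OF b] by (metis Int_lower2 card_mono)
    then have "(\<Sum>a\<in>layer k w. f (card (a \<inter> b)))
        = (\<Sum>j\<le>w. \<Sum>a\<in>{a \<in> layer k w. card (a \<inter> b) = j}. f (card (a \<inter> b)))"
      by (intro sum.group[symmetric]) auto
    also have "\<dots> = (\<Sum>j\<le>w. card {a \<in> layer k w. card (a \<inter> b) = j} * f j)"
      by simp
    also have "\<dots> \<le> (\<Sum>j\<le>w. (w choose j) * ((k - w) choose (w - j)) * f j)"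
      using b by (intro sum_mono mult_right_mono card_layer_Int) auto
    finally show ?thesis .
  qed
  then have "(\<Sum>b\<in>layer k w. \<Sum>a\<in>layer k w. f (card (a \<inter> b)))
    \<le> (\<Sum>b\<in>layer k w. \<Sum>j\<le>w. (w choose j) * ((k - w) choose (w - j)) * f j)"
    by (rule sum_mono)
  then show ?thesis by (simp add: card_layer)
qed

text \<open>
  The set \<open>b\<close> comes first and \<open>a\<close> second, since the sums below are evaluated for fixed \<open>b\<close>.
\<close>

definition bad_triples :: "nat \<Rightarrow> nat \<Rightarrow> (nat set \<times> nat set \<times> nat set) set" where
  "bad_triples k w = (SIGMA b : layer k w. SIGMA a : layer k w. {c \<in> layer k w. c \<subseteq> a \<union> b \<and> a \<subseteq> b \<union> c})"

definition bad_quads :: "nat \<Rightarrow> nat \<Rightarrow> (nat set \<times> nat set \<times> nat set \<times> nat set) set" where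
  "bad_quads k w = (SIGMA b : layer k w. SIGMA a : layer k w.
     {c \<in> layer k w. c \<subseteq> a \<union> b} \<times> {d \<in> layer k w. d \<subseteq> a \<union> b})"

lemma finite_bad_triples: "finite (bad_triples k w)"
  unfolding bad_triples_def by auto

lemma finite_bad_quads: "finite (bad_quads k w)"
  unfolding bad_quads_def by auto

text \<open>
  The two inclusions say that \<open>a\<close> and \<open>c\<close> agree outside \<open>b\<close>. So \<open>c\<close> is determined by \<open>c \<inter> b\<close>,
  and equality of the weights forces this set to have as many elements as \<open>a \<inter> b\<close>.
\<close>

lemma card_bad_triples_le:
  "card (bad_triples k w)
    \<le> (k choose w) * (\<Sum>j\<le>w. (w choose j) * ((k - w) choose (w - j)) * (w choose j))"
proof -
  have "card {c \<in> layer k w. c \<subseteq> a \<union> b \<and> a \<subseteq> b \<union> c} \<le> w choose card (a \<inter> b)"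
    if ab: "a \<in> layer k w" "b \<in> layer k w" for a b
  proof -
    note A = layerD[OF ab(1)] layerD[OF ab(2)]
    have "card {c \<in> layer k w. c \<subseteq> a \<union> b \<and> a \<subseteq> b \<union> c} \<le> card {s. s \<subseteq> b \<and> card s = card (a \<inter> b)}"
    proof (rule card_inj_on_le[where f = "\<lambda>c. c \<inter> b"])
      have diff: "c - b = a - b" if "c \<subseteq> a \<union> b" "a \<subseteq> b \<union> c" for c using that by blast
      show "inj_on (\<lambda>c. c \<inter> b) {c \<in> layer k w. c \<subseteq> a \<union> b \<and> a \<subseteq> b \<union> c}"
        by (rule inj_onI) blast
      have "card (c \<inter> b) = card (a \<inter> b)" if "c \<in> layer k w" "c \<subseteq> a \<union> b" "a \<subseteq> b \<union> c" for c
        using diff[OF that(2,3)] A layerD[OF that(1)] card_Int_Diff[of c b] card_Int_Diff[of a b] by simp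
      then show "(\<lambda>c. c \<inter> b) ` {c \<in> layer k w. c \<subseteq> a \<union> b \<and> a \<subseteq> b \<union> c}
          \<subseteq> {s. s \<subseteq> b \<and> card s = card (a \<inter> b)}" by auto
      show "finite {s. s \<subseteq> b \<and> card s = card (a \<inter> b)}"
        using A by (auto intro: finite_subset[of _ "Pow b"])
    qed
    then show ?thesis using A by (simp add: n_subsets)
  qed
  then have "(\<Sum>b\<in>layer k w. \<Sum>a\<in>layer k w. card {c \<in> layer k w. c \<subseteq> a \<union> b \<and> a \<subseteq> b \<union> c})
      \<le> (\<Sum>b\<in>layer k w. \<Sum>a\<in>layer k w. w choose card (a \<inter> b))"
    by (intro sum_mono) auto
  also have "\<dots> \<le> (k choose w) * (\<Sum>j\<le>w. (w choose j) * ((k - w) choose (w - j)) * (w choose j))"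
    by (rule sum_layer_pairs_le)
  finally show ?thesis
    unfolding bad_triples_def by (simp add: card_SigmaI finite_SigmaI)
qed

text \<open>
  Here \<open>c\<close> and \<open>d\<close> are arbitrary \<open>w\<close>-subsets of \<open>a \<union> b\<close>, chosen independently of each other.
\<close>

lemma card_bad_quads_le:
  "card (bad_quads k w)
    \<le> (k choose w) * (\<Sum>j\<le>w. (w choose j) * ((k - w) choose (w - j)) * ((2 * w - j) choose w)\<^sup>2)"
proof -
  have "card {c \<in> layer k w. c \<subseteq> a \<union> b} = (2 * w - card (a \<inter> b)) choose w"
    if ab: "a \<in> layer k w" "b \<in> layer k w" for a b
  proof -
    note A = layerD[OF ab(1)] layerD[OF ab(2)]
    have "{c \<in> layer k w. c \<subseteq> a \<union> b} = {c. c \<subseteq> a \<union> b \<and> card c = w}"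
      using A unfolding layer_def by auto
    moreover have "card (a \<union> b) = 2 * w - card (a \<inter> b)"
      using A card_Un_Int[of a b] by simp
    ultimately show ?thesis using A by (simp add: n_subsets)
  qed
  then have "(\<Sum>b\<in>layer k w. \<Sum>a\<in>layer k w. card {c \<in> layer k w. c \<subseteq> a \<union> b} * card {c \<in> layer k w. c \<subseteq> a \<union> b})
      = (\<Sum>b\<in>layer k w. \<Sum>a\<in>layer k w. ((2 * w - card (a \<inter> b)) choose w)\<^sup>2)"
    by (intro sum.cong) (auto simp: power2_eq_square)
  also have "\<dots> \<le> (k choose w) * (\<Sum>j\<le>w. (w choose j) * ((k - w) choose (w - j)) * ((2 * w - j) choose w)\<^sup>2)"
    by (rule sum_layer_pairs_le)
  finally show ?thesis
    unfolding bad_quads_def by (simp add: card_SigmaI finite_SigmaI card_cartesian_product)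
qed

section \<open>Words over a layer\<close>

definition words :: "nat \<Rightarrow> nat \<Rightarrow> nat \<Rightarrow> (nat \<Rightarrow> nat set) set" where
  "words k w m = PiE {..<m} (\<lambda>_. layer k w)"

text \<open>
  The support of the column obtained by writing the letters of a word one after the other: position
  \<open>j\<close> of letter \<open>i\<close> becomes the coordinate \<open>i * k + j\<close>.
\<close>

definition flatten :: "nat \<Rightarrow> nat \<Rightarrow> (nat \<Rightarrow> nat set) \<Rightarrow> nat set" where
  "flatten k m x = {r. r < m * k \<and> r mod k \<in> x (r div k)}"

lemma finite_words: "finite (words k w m)"
  unfolding words_def by (intro finite_PiE) auto

lemma card_words: "card (words k w m) = (k choose w) ^ m"
  unfolding words_def by (simp add: card_PiE card_layer)

lemma words_layer: "x \<in> words k w m \<Longrightarrow> i < m \<Longrightarrow> x i \<in> layer k w"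
  unfolding words_def by auto

lemma words_eqI: "x \<in> words k w m \<Longrightarrow> y \<in> words k w m \<Longrightarrow> (\<And>i. i < m \<Longrightarrow> x i = y i) \<Longrightarrow> x = y"
  unfolding words_def by (rule PiE_ext) auto

lemma flatten_subset_Un:
  assumes "x \<in> words k w m" "flatten k m x \<subseteq> flatten k m y \<union> flatten k m z" "i < m"
  shows "x i \<subseteq> y i \<union> z i"
proof
  fix j assume j: "j \<in> x i"
  then have "j < k" using layerD[OF words_layer[OF assms(1,3)]] by auto
  moreover have "i * k + j < m * k"
    using \<open>j < k\<close> assms(3) mult_le_mono1[of "Suc i" m k] by simp
  ultimately have "i * k + j \<in> flatten k m x" using j by (simp add: flatten_def)
  then have "i * k + j \<in> flatten k m y \<union> flatten k m z" using assms(2) by blast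
  then show "j \<in> y i \<union> z i" using \<open>j < k\<close> by (auto simp: flatten_def)
qed

lemma flatten_subset_imp_eq:
  assumes "x \<in> words k w m" "y \<in> words k w m" "flatten k m x \<subseteq> flatten k m y"
  shows "x = y"
proof (rule words_eqI[OF assms(1,2)])
  fix i assume i: "i < m"
  have "x i \<subseteq> y i" using flatten_subset_Un[OF assms(1) _ i, of y y] assms(3) by simp
  then show "x i = y i"
    using layerD[OF words_layer[OF assms(1) i]] layerD[OF words_layer[OF assms(2) i]]
    by (metis card_subset_eq)
qed

definition bad_word_triples where
  "bad_word_triples k w m = {(y, x, z). y \<in> words k w m \<and> x \<in> words k w m \<and> z \<in> words k w m \<and>
     (\<forall>i<m. (y i, x i, z i) \<in> bad_triples k w)}"

definition bad_word_quads where
  "bad_word_quads k w m = {(y, x, z, t). y \<in> words k w m \<and> x \<in> words k w m \<and> z \<in> words k w m \<and>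
     t \<in> words k w m \<and> (\<forall>i<m. (y i, x i, z i, t i) \<in> bad_quads k w)}"

text \<open>
  Regrouping a tuple of words as a word of tuples turns a condition imposed on each letter into a
  product, so the count is a power.
\<close>

lemma card_bad_word_triples_le:
  "card (bad_word_triples k w m) \<le> card (bad_triples k w) ^ m"
proof -
  let ?f = "\<lambda>(y, x, z). \<lambda>i\<in>{..<m}. (y i, x i, z i)"
  have "card (bad_word_triples k w m) \<le> card (PiE {..<m} (\<lambda>_. bad_triples k w))"
  proof (rule card_inj_on_le[where f = ?f])
    show "inj_on ?f (bad_word_triples k w m)"
    proof (rule inj_onI)
      fix u u' assume *: "u \<in> bad_word_triples k w m" "u' \<in> bad_word_triples k w m" "?f u = ?f u'"
      obtain y x z y' x' z' where u: "u = (y, x, z)" "u' = (y', x', z')"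
        by (metis surj_pair)
      have "(y i, x i, z i) = (y' i, x' i, z' i)" if "i < m" for i
        using fun_cong[OF *(3), of i] that u by simp
      then show "u = u'"
        using * unfolding u by (auto simp: bad_word_triples_def intro!: words_eqI)
    qed
    show "?f ` bad_word_triples k w m \<subseteq> PiE {..<m} (\<lambda>_. bad_triples k w)"
      by (auto simp: bad_word_triples_def split: if_splits)
    show "finite (PiE {..<m} (\<lambda>_. bad_triples k w))"
      by (intro finite_PiE finite_bad_triples) auto
  qed
  then show ?thesis by (simp add: card_PiE)
qed

lemma card_bad_word_quads_le:
  "card (bad_word_quads k w m) \<le> card (bad_quads k w) ^ m"
proof -
  let ?f = "\<lambda>(y, x, z, t). \<lambda>i\<in>{..<m}. (y i, x i, z i, t i)"
  have "card (bad_word_quads k w m) \<le> card (PiE {..<m} (\<lambda>_. bad_quads k w))"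
  proof (rule card_inj_on_le[where f = ?f])
    show "inj_on ?f (bad_word_quads k w m)"
    proof (rule inj_onI)
      fix u u' assume *: "u \<in> bad_word_quads k w m" "u' \<in> bad_word_quads k w m" "?f u = ?f u'"
      obtain y x z t y' x' z' t' where u: "u = (y, x, z, t)" "u' = (y', x', z', t')"
        by (metis surj_pair)
      have "(y i, x i, z i, t i) = (y' i, x' i, z' i, t' i)" if "i < m" for i
        using fun_cong[OF *(3), of i] that u by simp
      then show "u = u'"
        using * unfolding u by (auto simp: bad_word_quads_def intro!: words_eqI)
    qed
    show "?f ` bad_word_quads k w m \<subseteq> PiE {..<m} (\<lambda>_. bad_quads k w)"
      by (auto simp: bad_word_quads_def split: if_splits)
    show "finite (PiE {..<m} (\<lambda>_. bad_quads k w))"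
      by (intro finite_PiE finite_bad_quads) auto
  qed
  then show ?thesis by (simp add: card_PiE)
qed

lemma exists_large_code:
  assumes M: "M \<le> (k choose w) ^ m"
    and T: "card (bad_triples k w) \<le> p" and Q: "card (bad_quads k w) \<le> q"
  obtains S where "S \<subseteq> words k w m"
    "\<And>x y z. \<lbrakk>x \<in> S; y \<in> S; z \<in> S; distinct [y, x, z]\<rbrakk> \<Longrightarrow> (y, x, z) \<notin> bad_word_triples k w m"
    "\<And>x y z t. \<lbrakk>x \<in> S; y \<in> S; z \<in> S; t \<in> S; distinct [y, x, z, t]\<rbrakk>
      \<Longrightarrow> (y, x, z, t) \<notin> bad_word_quads k w m"
    "real (card S) \<ge> real M - (real p ^ m * (real M / real (k choose w) ^ m) ^ 3
      + real q ^ m * (real M / real (k choose w) ^ m) ^ 4)"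
proof -
  define D3 where "D3 = {(y, x, z) \<in> bad_word_triples k w m. distinct [y, x, z]}"
  define D4 where "D4 = {(y, x, z, t) \<in> bad_word_quads k w m. distinct [y, x, z, t]}"
  define E3 where "E3 = (\<lambda>(y, x, z). {y, x, z}) ` D3"
  define E4 where "E4 = (\<lambda>(y, x, z, t). {y, x, z, t}) ` D4"
  define c where "c = real M / real (k choose w) ^ m"
  have c: "0 \<le> c" by (simp add: c_def)
  have fin3: "finite (bad_word_triples k w m)"
    by (rule finite_subset[of _ "words k w m \<times> words k w m \<times> words k w m"])
      (auto simp: bad_word_triples_def finite_words)
  have fin4: "finite (bad_word_quads k w m)"
    by (rule finite_subset[of _ "words k w m \<times> words k w m \<times> words k w m \<times> words k w m"])
      (auto simp: bad_word_quads_def finite_words)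
  have D3: "D3 \<subseteq> bad_word_triples k w m" and D4: "D4 \<subseteq> bad_word_quads k w m"
    by (auto simp: D3_def D4_def)
  have finE: "finite E3" "finite E4"
    unfolding E3_def E4_def using finite_subset[OF D3 fin3] finite_subset[OF D4 fin4] by auto
  have "card E3 \<le> card D3" unfolding E3_def using finite_subset[OF D3 fin3] by (rule card_image_le)
  also have "\<dots> \<le> card (bad_word_triples k w m)" using D3 fin3 by (rule card_mono[rotated])
  also have "\<dots> \<le> p ^ m" using card_bad_word_triples_le power_mono[OF T] le_trans by blast
  finally have cE3: "real (card E3) \<le> real p ^ m" by (simp flip: of_nat_power)
  have "card E4 \<le> card D4" unfolding E4_def using finite_subset[OF D4 fin4] by (rule card_image_le)
  also have "\<dots> \<le> card (bad_word_quads k w m)" using D4 fin4 by (rule card_mono[rotated])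
  also have "\<dots> \<le> q ^ m" using card_bad_word_quads_le power_mono[OF Q] le_trans by blast
  finally have cE4: "real (card E4) \<le> real q ^ m" by (simp flip: of_nat_power)
  have size: "card e = 3" if "e \<in> E3" for e using that by (auto simp: E3_def D3_def)
  have size': "card e = 4" if "e \<in> E4" for e using that by (auto simp: E4_def D4_def)
  have "(\<Sum>e\<in>E3 \<union> E4. c ^ card e) \<le> (\<Sum>e\<in>E3. c ^ card e) + (\<Sum>e\<in>E4. c ^ card e)"
  proof -
    have "0 \<le> (\<Sum>e\<in>E3 \<inter> E4. c ^ card e)" using c by (simp add: sum_nonneg)
    then show ?thesis using sum.union_inter[OF finE, of "\<lambda>e. c ^ card e"] by linarith
  qed
  also have "\<dots> = real (card E3) * c ^ 3 + real (card E4) * c ^ 4"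
    using size size' by simp
  also have "\<dots> \<le> real p ^ m * c ^ 3 + real q ^ m * c ^ 4"
    using cE3 cE4 c by (intro add_mono mult_right_mono) auto
  finally have bound: "(\<Sum>e\<in>E3 \<union> E4. c ^ card e) \<le> real p ^ m * c ^ 3 + real q ^ m * c ^ 4" .
  have sub: "e \<subseteq> words k w m" if "e \<in> E3 \<union> E4" for e
    using that by (auto simp: E3_def E4_def D3_def D4_def bad_word_triples_def bad_word_quads_def)
  have ne: "{} \<notin> E3 \<union> E4" using size size' by fastforce
  have "M \<le> card (words k w m)" using M by (simp add: card_words)
  then obtain S where S: "S \<subseteq> words k w m" "\<And>e. e \<in> E3 \<union> E4 \<Longrightarrow> \<not> e \<subseteq> S"
    "real (card S) \<ge> real M - (\<Sum>e\<in>E3 \<union> E4. (real M / real (card (words k w m))) ^ card e)"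
    using exists_large_independent_set[OF finite_words _ finite_UnI[OF finE] sub ne] by blast
  show ?thesis
  proof (rule that[OF S(1)])
    fix x y z assume *: "x \<in> S" "y \<in> S" "z \<in> S" "distinct [y, x, z]"
    show "(y, x, z) \<notin> bad_word_triples k w m"
    proof
      assume "(y, x, z) \<in> bad_word_triples k w m"
      then have "(y, x, z) \<in> D3" using *(4) by (simp only: D3_def mem_Collect_eq case_prod_conv simp_thms)
      from imageI[OF this, of "\<lambda>(y, x, z). {y, x, z}"] have "{y, x, z} \<in> E3"
        unfolding E3_def by (simp only: case_prod_conv)
      then show False using S(2)[of "{y, x, z}"] * by blast
    qed
  next
    fix x y z t assume *: "x \<in> S" "y \<in> S" "z \<in> S" "t \<in> S" "distinct [y, x, z, t]"
    show "(y, x, z, t) \<notin> bad_word_quads k w m"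
    proof
      assume "(y, x, z, t) \<in> bad_word_quads k w m"
      then have "(y, x, z, t) \<in> D4" using *(5) by (simp only: D4_def mem_Collect_eq case_prod_conv simp_thms)
      from imageI[OF this, of "\<lambda>(y, x, z, t). {y, x, z, t}"] have "{y, x, z, t} \<in> E4"
        unfolding E4_def by (simp only: case_prod_conv)
      then show False using S(2)[of "{y, x, z, t}"] * by blast
    qed
  next
    show "real (card S) \<ge> real M - (real p ^ m * (real M / real (k choose w) ^ m) ^ 3
      + real q ^ m * (real M / real (k choose w) ^ m) ^ 4)"
      using S(3) bound by (simp add: card_words c_def)
  qed
qed

text \<open>
  Inclusions between columns restrict to the blocks. The configurations excluded in
  \<open>mem_of_Union_eq_Un\<close> therefore yield bad tuples of words, and incomparability holds because all
  letters have the same weight.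
\<close>

lemma SSM_ge_card_code:
  assumes S: "S \<subseteq> words k w m" and n: "2 \<le> m * k" "m * k \<le> card S"
    and triple: "\<And>x y z. \<lbrakk>x \<in> S; y \<in> S; z \<in> S; distinct [y, x, z]\<rbrakk>
      \<Longrightarrow> (y, x, z) \<notin> bad_word_triples k w m"
    and quad: "\<And>x y z t. \<lbrakk>x \<in> S; y \<in> S; z \<in> S; t \<in> S; distinct [y, x, z, t]\<rbrakk>
      \<Longrightarrow> (y, x, z, t) \<notin> bad_word_quads k w m"
  shows "card S \<le> SSM 2 (m * k)"
proof -
  define F where "F = flatten k m ` S"
  have inj: "inj_on (flatten k m) S"
    using S by (intro inj_onI flatten_subset_imp_eq) auto
  have cardF: "card F = card S" unfolding F_def using inj by (rule card_image)
  have W: "x \<in> words k w m" if "x \<in> S" for x using that S by blast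
  have "a \<in> G" if "a \<in> F" "b \<in> F" "a \<noteq> b" "G \<subseteq> F" "\<Union>G = a \<union> b" for a b G
  proof (rule mem_of_Union_eq_Un[OF that])
    obtain x y where xy: "x \<in> S" "a = flatten k m x" "y \<in> S" "b = flatten k m y"
      using \<open>a \<in> F\<close> \<open>b \<in> F\<close> F_def by auto
    show "\<not> a \<subseteq> b" using flatten_subset_imp_eq[of x k w m y] xy W \<open>a \<noteq> b\<close> by blast
    show False if c: "c \<in> F" "c \<noteq> a" "c \<noteq> b" "c \<subseteq> a \<union> b" "a \<subseteq> b \<union> c" for c
    proof -
      obtain z where z: "z \<in> S" "c = flatten k m z" using \<open>c \<in> F\<close> F_def by auto
      have "(y i, x i, z i) \<in> bad_triples k w" if "i < m" for i
        using flatten_subset_Un[of z k w m x y i] flatten_subset_Un[of x k w m y z i]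
          W[OF \<open>x \<in> S\<close>] W[OF \<open>y \<in> S\<close>] W[OF \<open>z \<in> S\<close>] c xy z that words_layer
        by (auto simp: bad_triples_def)
      then have "(y, x, z) \<in> bad_word_triples k w m"
        using W xy z by (auto simp: bad_word_triples_def)
      moreover have "distinct [y, x, z]" using c xy z \<open>a \<noteq> b\<close> by auto
      ultimately show False using triple xy z by blast
    qed
    show False if c: "c \<in> F" "d \<in> F" "c \<noteq> a" "c \<noteq> b" "d \<noteq> a" "d \<noteq> b" "c \<noteq> d"
      "c \<subseteq> a \<union> b" "d \<subseteq> a \<union> b" for c d
    proof -
      obtain z t where z: "z \<in> S" "c = flatten k m z" "t \<in> S" "d = flatten k m t"
        using \<open>c \<in> F\<close> \<open>d \<in> F\<close> F_def by auto
      have "(y i, x i, z i, t i) \<in> bad_quads k w" if "i < m" for i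
        using flatten_subset_Un[of z k w m x y i] flatten_subset_Un[of t k w m x y i]
          W[OF \<open>x \<in> S\<close>] W[OF \<open>y \<in> S\<close>] W[OF \<open>z \<in> S\<close>] W[OF \<open>t \<in> S\<close>] c xy z that words_layer
        by (auto simp: bad_quads_def)
      then have "(y, x, z, t) \<in> bad_word_quads k w m"
        using W xy z by (auto simp: bad_word_quads_def)
      moreover have "distinct [y, x, z, t]" using c xy z \<open>a \<noteq> b\<close> by auto
      ultimately show False using quad xy z by blast
    qed
  qed
  note sep = this
  have "F \<subseteq> Pow {..<m * k}" by (auto simp: F_def flatten_def)
  moreover have "m * k \<le> card F" using n(2) cardF by simp
  ultimately have "\<exists>B \<in> carrier_mat (m * k) (card F). strongly_separable 2 B"
    using sep by (rule strongly_separable_of_family[OF n(1)])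
  then show ?thesis using SSM_ge cardF by metis
qed

section \<open>The choice of parameters\<close>

lemma choose_20_5: "20 choose 5 = (15504::nat)"
  by (simp add: binomial_fact' fact_numeral)

lemma card_bad_triples_20_5: "card (bad_triples 20 5) \<le> 15504 * 93504"
proof -
  have "(\<Sum>j\<le>5. (5 choose j) * ((20 - 5) choose (5 - j)) * (5 choose j)) = (93504::nat)"
    by (simp add: binomial_fact' fact_numeral atMost_nat_numeral)
  then show ?thesis using card_bad_triples_le[of 20 5] by (simp add: choose_20_5)
qed

lemma card_bad_quads_20_5: "card (bad_quads 20 5) \<le> 15504 * 313790763"
proof -
  have "(\<Sum>j\<le>5. (5 choose j) * ((20 - 5) choose (5 - j)) * ((2 * 5 - j) choose 5)\<^sup>2) = (313790763::nat)"
    by (simp add: binomial_fact' fact_numeral atMost_nat_numeral)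
  then show ?thesis using card_bad_quads_le[of 20 5] by (simp add: choose_20_5)
qed

text \<open>
  Each of the two deletion terms is at most \<open>M / 4\<close>. Relative to \<open>M = 2 ^ (9 l)\<close>, the term of the
  triples is at most \<open>(1/25) ^ l\<close> and that of the quadruples at most \<open>(20/21) ^ l\<close>. The second base is
  close to \<open>1\<close> because the rate \<open>0.225\<close> is close to the limit \<open>0.2255...\<close> of the construction;
  \<open>l \<ge> 30\<close> is enough for \<open>(20/21) ^ l \<le> 1/4\<close>.
\<close>

lemma SSM_ge_power:
  assumes l: "l \<ge> 30"
  shows "2 ^ (9 * l - 1) \<le> SSM 2 (40 * l)"
proof -
  define N :: real where "N = 15504"
  define p :: nat where "p = 15504 * 93504"
  define q :: nat where "q = 15504 * 313790763"
  have "(2::nat) ^ (9 * l) = (2 ^ 9) ^ l" by (rule power_mult)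
  also have "\<dots> \<le> (15504\<^sup>2) ^ l" by (rule power_mono) auto
  also have "\<dots> = 15504 ^ (2 * l)" by (rule power_mult[symmetric])
  finally have M: "2 ^ (9 * l) \<le> (20 choose 5 :: nat) ^ (2 * l)" unfolding choose_20_5 .
  obtain S where S: "S \<subseteq> words 20 5 (2 * l)"
    "\<And>x y z. \<lbrakk>x \<in> S; y \<in> S; z \<in> S; distinct [y, x, z]\<rbrakk> \<Longrightarrow> (y, x, z) \<notin> bad_word_triples 20 5 (2 * l)"
    "\<And>x y z t. \<lbrakk>x \<in> S; y \<in> S; z \<in> S; t \<in> S; distinct [y, x, z, t]\<rbrakk>
      \<Longrightarrow> (y, x, z, t) \<notin> bad_word_quads 20 5 (2 * l)"
    "real (card S) \<ge> real (2 ^ (9 * l))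
      - (real p ^ (2 * l) * (real (2 ^ (9 * l)) / real (20 choose 5) ^ (2 * l)) ^ 3
      + real q ^ (2 * l) * (real (2 ^ (9 * l)) / real (20 choose 5) ^ (2 * l)) ^ 4)"
    using exists_large_code[OF M card_bad_triples_20_5 card_bad_quads_20_5]
    unfolding p_def q_def by blast
  have ratio: "(real (2 ^ (9 * l)) / real (20 choose 5) ^ (2 * l)) ^ r = ((2 ^ 9 / N\<^sup>2) ^ r) ^ l" for r
  proof -
    have "real (2 ^ (9 * l)) / real (20 choose 5) ^ (2 * l) = (2 ^ 9 / N\<^sup>2) ^ l"
      unfolding choose_20_5 N_def by (simp only: of_nat_power of_nat_numeral power_mult power_divide)
    then show ?thesis by (simp only: power_mult[symmetric] mult.commute)
  qed
  have split: "real u ^ (2 * l) * (x ^ r) ^ l = (real u ^ 2 * x ^ r) ^ l" for u x r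
    by (simp only: power_mult power_mult_distrib)
  have "real p ^ (2 * l) * ((2 ^ 9 / N\<^sup>2) ^ 3) ^ l \<le> (2 ^ 9 * (1 / 25)) ^ l"
    unfolding split by (rule power_mono) (simp_all add: p_def N_def power_divide)
  also have "\<dots> = 2 ^ (9 * l) * (1 / 25) ^ l" by (simp only: power_mult power_mult_distrib)
  also have "\<dots> \<le> 2 ^ (9 * l) * (1 / 4)"
    using l power_decreasing[of 1 l "1 / 25 :: real"] by (intro mult_left_mono) auto
  finally have le3: "real p ^ (2 * l) * ((2 ^ 9 / N\<^sup>2) ^ 3) ^ l \<le> 2 ^ (9 * l) * (1 / 4)" .
  have "real q ^ (2 * l) * ((2 ^ 9 / N\<^sup>2) ^ 4) ^ l \<le> (2 ^ 9 * (20 / 21)) ^ l"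
    unfolding split by (rule power_mono) (simp_all add: q_def N_def power_divide)
  also have "\<dots> = 2 ^ (9 * l) * (20 / 21) ^ l" by (simp only: power_mult power_mult_distrib)
  also have "\<dots> \<le> 2 ^ (9 * l) * (20 / 21) ^ 30"
    using l by (intro mult_left_mono power_decreasing) auto
  also have "\<dots> \<le> 2 ^ (9 * l) * (1 / 4)" by (intro mult_left_mono) (simp_all add: power_divide)
  finally have le4: "real q ^ (2 * l) * ((2 ^ 9 / N\<^sup>2) ^ 4) ^ l \<le> 2 ^ (9 * l) * (1 / 4)" .
  have "real (card S) \<ge> 2 ^ (9 * l) / 2" 
    using S(4) le3 le4 unfolding ratio unfolding of_nat_power of_nat_numeral by linarith
  moreover have "(2::real) ^ (9 * l) = 2 * 2 ^ (9 * l - 1)"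
    using l by (simp flip: power_Suc)
  ultimately have "real (card S) \<ge> real (2 ^ (9 * l - 1))" by simp
  then have cardS: "card S \<ge> 2 ^ (9 * l - 1)" by (simp only: of_nat_le_iff)
  have "40 * l \<le> 2 ^ 6 * 2 ^ l" by (intro mult_le_mono) auto
  also have "\<dots> = 2 ^ (6 + l)" by (simp add: power_add)
  also have "\<dots> \<le> 2 ^ (9 * l - 1)" using l by (intro power_increasing) auto
  finally have "40 * l \<le> card S" using cardS by simp
  then have "2 * l * 20 \<le> card S" by simp
  moreover have "2 \<le> 2 * l * 20" using l by simp
  ultimately have "card S \<le> SSM 2 (2 * l * 20)"
    using SSM_ge_card_code[OF S(1) _ _ S(2,3)] by blast
  then show ?thesis using cardS by (simp add: mult.commute mult.left_commute)
qed

theorem mainTheorem2: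
  shows "limsup (\<lambda>n::nat. ereal (log 2 (real (SSM 2 n)) / real n)) \<ge> ereal 0.2237"
proof -
  let ?X = "\<lambda>n::nat. ereal (log 2 (real (SSM 2 n)) / real n)"
  \<comment> \<open>On the lengths \<open>40 l\<close> the rate is at least \<open>(9 l - 1) / (40 l)\<close>, which exceeds \<open>0.2237\<close> for \<open>l \<ge> 20\<close>.\<close>
  have "ereal 0.2237 \<le> (?X \<circ> (\<lambda>l. 40 * l)) l" if l: "l \<ge> 30" for l
  proof -
    have "real (2 ^ (9 * l - 1)) \<le> real (SSM 2 (40 * l))"
      using SSM_ge_power[OF l] by (simp only: of_nat_le_iff)
    then have "log 2 (2 ^ (9 * l - 1)) \<le> log 2 (real (SSM 2 (40 * l)))"
      by (intro log_mono) simp_all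
    moreover have "log 2 (2 ^ (9 * l - 1)) = real (9 * l - 1)" by simp
    ultimately have "9 * real l - 1 \<le> log 2 (real (SSM 2 (40 * l)))" using l by (simp add: of_nat_diff)
    moreover have "0.2237 * (40 * real l) \<le> 9 * real l - 1" using l by simp
    ultimately show ?thesis using l by (simp add: field_simps)
  qed
  then have "eventually (\<lambda>l. ereal 0.2237 \<le> (?X \<circ> (\<lambda>l. 40 * l)) l) sequentially"
    by (rule eventually_sequentiallyI)
  then have "ereal 0.2237 \<le> limsup (?X \<circ> (\<lambda>l. 40 * l))"
    by (intro le_Limsup) auto
  also have "\<dots> \<le> limsup ?X"
    by (intro limsup_subseq_mono strict_monoI) auto
  finally show ?thesis .
qed

end
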